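(* Let $\mu$ be a strictly non-degenerate probability measure on the group $\widetilde F$ (i.e. the semigroup generated by $\operatorname{supp}\mu$ is all of $\widetilde F$). Then the induced random walk $(\Gamma,\mu)$ on $\Gamma\cong\mathbb{Z}[\frac12]$, i.e. the Markov chain on $\mathbb{Z}[\frac12]$ which from $\gamma$ moves to $\gamma.g=g(\gamma)$ with probability $\mu(g)$, $g\in\widetilde F$ (probabilities of coinciding targets being added), is transient.
   Context: $\widetilde A,\widetilde B:\mathbb{R}\to\mathbb{R}$ are the piecewise linear homeomorphisms $\widetilde A(\gamma)=\gamma-1$ and $\widetilde B(\gamma)=\gamma$ for $\gamma\le 0$, $\widetilde B(\gamma)=\gamma/2$ for $0\le\gamma\le 2$, $\widetilde B(\gamma)=\gamma-1$ for $\gamma\ge 2$. $\widetilde F$ is the group of homeomorphisms of $\mathbb{R}$ generated by $\widetilde A$ and $\widetilde B$ (it is isomorphic to Thompson's group $F$), with group operation $(g_1g_2)(\gamma)=g_2(g_1(\gamma))$, so that $\gamma.g=g(\gamma)$ is a right action of $\widetilde F$ on $\mathbb{R}$. This action preserves the set $\mathbb{Z}[\frac12]$ of dyadic rationals and is transitive on it. $\Gamma$ is the Schreier graph of this action on $\mathbb{Z}[\frac12]$ with respect to the generating set $\{\widetilde A^{\pm1},\widetilde B^{\pm1}\}$; its vertex set is $\mathbb{Z}[\frac12]$. Transient means that almost every sample path goes to infinity (leaves every finite subset of the state space forever); equivalently, the expected number of visits to any state is finite. *)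

theory Defs
  imports "HOL-Probability.Probability" "HOL-Algebra.Generated_Groups"
begin

section \<open>The group\<close>

text \<open>
  The product \<open>g \<otimes> h\<close> is ``first \<open>g\<close>, then \<open>h\<close>'', so that \<open>(\<gamma>, g) \<mapsto> g \<gamma>\<close> is a right action.
\<close>
definition Homeo_real :: "(real \<Rightarrow> real) monoid" where
  "Homeo_real =
    \<lparr>carrier = {g. \<exists>h. homeomorphism UNIV UNIV g h},
     mult = (\<lambda>g h. h \<circ> g),
     one = id\<rparr>"

definition A_map :: "real \<Rightarrow> real" where
  "A_map \<gamma> = \<gamma> - 1"

definition B_map :: "real \<Rightarrow> real" where
  "B_map \<gamma> = (if \<gamma> \<le> 0 then \<gamma> else if \<gamma> \<le> 2 then \<gamma> / 2 else \<gamma> - 1)"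

definition thompson_F :: "(real \<Rightarrow> real) monoid" where
  "thompson_F = Homeo_real \<lparr>carrier := generate Homeo_real {A_map, B_map}\<rparr>"

definition dyadic_rationals :: "real set" where
  "dyadic_rationals = {of_int a / 2 ^ n | (a :: int) (n :: nat). True}"

lemma group_Homeo_real: "group Homeo_real"
proof (rule groupI)
  fix g h assume "g \<in> carrier Homeo_real" "h \<in> carrier Homeo_real"
  then show "g \<otimes>\<^bsub>Homeo_real\<^esub> h \<in> carrier Homeo_real"
    by (auto simp: Homeo_real_def intro: homeomorphism_compose)
next
  fix g assume "g \<in> carrier Homeo_real"
  then obtain h where h: "homeomorphism UNIV UNIV g h"
    by (auto simp: Homeo_real_def)
  then have "h \<in> carrier Homeo_real" "h \<otimes>\<^bsub>Homeo_real\<^esub> g = \<one>\<^bsub>Homeo_real\<^esub>"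
    by (auto simp: Homeo_real_def homeomorphism_def fun_eq_iff)
  then show "\<exists>h\<in>carrier Homeo_real. h \<otimes>\<^bsub>Homeo_real\<^esub> g = \<one>\<^bsub>Homeo_real\<^esub>"
    by blast
qed (auto simp: Homeo_real_def comp_assoc homeomorphism_ident id_def intro!: exI[of _ "\<lambda>x. x"])

lemma homeomorphism_A_map: "homeomorphism UNIV UNIV A_map (\<lambda>\<gamma>. \<gamma> + 1)"
  by (rule homeomorphismI) (auto simp: A_map_def [abs_def] intro!: continuous_intros)

lemma homeomorphism_B_map: "homeomorphism UNIV UNIV B_map (\<lambda>\<gamma>. max \<gamma> (min (2 * \<gamma>) (\<gamma> + 1)))"
proof (rule homeomorphismI)
  have eq: "B_map = (\<lambda>\<gamma>. min \<gamma> (max (\<gamma> / 2) (\<gamma> - 1)))"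
    by (auto simp: B_map_def fun_eq_iff)
  show "continuous_on UNIV B_map"
    unfolding eq by (intro continuous_intros) simp
  show "continuous_on UNIV (\<lambda>\<gamma> :: real. max \<gamma> (min (2 * \<gamma>) (\<gamma> + 1)))"
    by (intro continuous_intros)
qed (auto simp: B_map_def max_def min_def)

lemma generators_in_Homeo_real: "{A_map, B_map} \<subseteq> carrier Homeo_real"
  using homeomorphism_A_map homeomorphism_B_map by (auto simp: Homeo_real_def)

lemma group_thompson_F: "group thompson_F"
  unfolding thompson_F_def
  using group.generate_is_subgroup[OF group_Homeo_real generators_in_Homeo_real]
  by (rule subgroup.subgroup_is_group) (rule group_Homeo_real)

lemma dyadic_rationalsI: "x = of_int a / 2 ^ n \<Longrightarrow> x \<in> dyadic_rationals"
  by (auto simp: dyadic_rationals_def)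

lemma A_map_image_dyadic: "A_map ` dyadic_rationals = dyadic_rationals"
proof (intro equalityI subsetI)
  fix x assume "x \<in> A_map ` dyadic_rationals"
  then obtain a n where "x = of_int a / 2 ^ n - 1"
    by (auto simp: A_map_def dyadic_rationals_def)
  then show "x \<in> dyadic_rationals"
    by (intro dyadic_rationalsI[of _ "a - 2 ^ n" n]) (simp add: field_simps)
next
  fix x assume "x \<in> dyadic_rationals"
  then obtain a n where "x = of_int a / 2 ^ n"
    by (auto simp: dyadic_rationals_def)
  then have "x + 1 \<in> dyadic_rationals"
    by (intro dyadic_rationalsI[of _ "a + 2 ^ n" n]) (simp add: field_simps)
  then show "x \<in> A_map ` dyadic_rationals"
    by (rule rev_image_eqI) (simp add: A_map_def)
qed

lemma B_map_image_dyadic: "B_map ` dyadic_rationals = dyadic_rationals"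
proof (intro equalityI subsetI)
  fix x assume "x \<in> B_map ` dyadic_rationals"
  then obtain a n where "x = B_map (of_int a / 2 ^ n)"
    by (auto simp: dyadic_rationals_def)
  then consider "x = of_int a / 2 ^ n" | "x = of_int a / 2 ^ n / 2" | "x = of_int a / 2 ^ n - 1"
    by (auto simp: B_map_def split: if_splits)
  then show "x \<in> dyadic_rationals"
  proof cases
    case 1 then show ?thesis by (rule dyadic_rationalsI)
  next
    case 2 then show ?thesis
      by (intro dyadic_rationalsI[of _ a "Suc n"]) simp
  next
    case 3 then show ?thesis
      by (intro dyadic_rationalsI[of _ "a - 2 ^ n" n]) (simp add: field_simps)
  qed
next
  fix x assume x: "x \<in> dyadic_rationals"
  then obtain a n where an: "x = of_int a / 2 ^ n"
    by (auto simp: dyadic_rationals_def)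
  have "x + 1 \<in> dyadic_rationals" "2 * x \<in> dyadic_rationals"
    using an dyadic_rationalsI[of "x + 1" "a + 2 ^ n" n] dyadic_rationalsI[of "2 * x" "2 * a" n]
    by (simp_all add: field_simps)
  then have "max x (min (2 * x) (x + 1)) \<in> dyadic_rationals"
    using x by (simp add: max_def min_def)
  moreover have "x = B_map (max x (min (2 * x) (x + 1)))"
    using homeomorphism_B_map by (simp add: homeomorphism_def)
  ultimately show "x \<in> B_map ` dyadic_rationals"
    by (rule rev_image_eqI)
qed

text \<open>In particular the walks below stay in \<open>dyadic_rationals\<close> when started there.\<close>
lemma thompson_F_image_dyadic:
  assumes "g \<in> carrier thompson_F"
  shows "g ` dyadic_rationals = dyadic_rationals"
proof -
  interpret group Homeo_real by (rule group_Homeo_real)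
  have gens: "h ` dyadic_rationals = dyadic_rationals" if "h \<in> {A_map, B_map}" for h
    using that A_map_image_dyadic B_map_image_dyadic by auto
  have "g \<in> generate Homeo_real {A_map, B_map}"
    using assms by (simp add: thompson_F_def)
  then show ?thesis
  proof induction
    case (inv h)
    then have "h \<otimes>\<^bsub>Homeo_real\<^esub> inv\<^bsub>Homeo_real\<^esub> h = \<one>\<^bsub>Homeo_real\<^esub>"
      using generators_in_Homeo_real by (intro r_inv) auto
    then have "(inv\<^bsub>Homeo_real\<^esub> h \<circ> h) ` dyadic_rationals = dyadic_rationals"
      by (simp add: Homeo_real_def)
    then show ?case
      using gens[OF inv] by (simp only: image_comp[symmetric])
  next
    case (eng h1 h2)
    then have "h2 ` h1 ` dyadic_rationals = dyadic_rationals"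
      by simp
    then show ?case
      by (simp add: Homeo_real_def image_image)
  qed (use gens in \<open>auto simp: Homeo_real_def\<close>)
qed


section \<open>Markov chains and transience\<close>

text \<open>
  The law on path space \<open>nat \<Rightarrow> 'a\<close> of the time-homogeneous Markov chain with one-step transition
  probabilities \<open>K\<close> started at \<open>x\<close>.  It is obtained from the Ionescu-Tulcea theorem, where the
  distribution of the \<open>n\<close>-th coordinate is prescribed given coordinates \<open>0\<close> to \<open>n - 1\<close>; its
  finite-dimensional distributions are spelled out in \<open>path_measure_cylinder\<close>.
\<close>
definition chain_step :: "('a \<Rightarrow> 'a pmf) \<Rightarrow> 'a \<Rightarrow> nat \<Rightarrow> (nat \<Rightarrow> 'a) \<Rightarrow> 'a measure" where
  "chain_step K x n \<omega> = measure_pmf (case n of 0 \<Rightarrow> return_pmf x | Suc m \<Rightarrow> K (\<omega> m))"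

definition path_measure :: "('a \<Rightarrow> 'a pmf) \<Rightarrow> 'a \<Rightarrow> (nat \<Rightarrow> 'a) measure" where
  "path_measure K x =
    projective_family.lim UNIV
      (Ionescu_Tulcea.CI (chain_step K x) (\<lambda>_. count_space UNIV)) (\<lambda>_. count_space UNIV)"

definition transient :: "'a set \<Rightarrow> ('a \<Rightarrow> 'a pmf) \<Rightarrow> bool" where
  "transient S K \<longleftrightarrow>
    (\<forall>x\<in>S. AE \<omega> in path_measure K x.
      \<forall>V. finite V \<and> V \<subseteq> S \<longrightarrow> (\<forall>\<^sub>F n in sequentially. \<omega> n \<notin> V))"

lemma Ionescu_Tulcea_chain_step: "Ionescu_Tulcea (chain_step K x) (\<lambda>_. count_space UNIV)"
proof (rule Ionescu_Tulcea.intro)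
  fix n :: nat
  show "chain_step K x n \<in>
      measurable (PiM {0..<n} (\<lambda>_. count_space UNIV)) (subprob_algebra (count_space UNIV))"
  proof (cases n)
    case 0
    have "chain_step K x 0 = (\<lambda>_. measure_pmf (return_pmf x))"
      by (simp add: chain_step_def fun_eq_iff)
    then show ?thesis
      using 0 by (simp add: measure_pmf_in_subprob_space)
  next
    case (Suc m)
    have "(\<lambda>\<omega>. \<omega> m) \<in> measurable (PiM {0..<n} (\<lambda>_. count_space UNIV)) (count_space UNIV)"
      using Suc by (intro measurable_component_singleton) auto
    then have "(\<lambda>\<omega>. measure_pmf (K (\<omega> m))) \<in>
        measurable (PiM {0..<n} (\<lambda>_. count_space UNIV)) (subprob_algebra (count_space UNIV))"
      by (rule measurable_compose) (simp add: measure_pmf_in_subprob_space)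
    moreover have "chain_step K x n = (\<lambda>\<omega>. measure_pmf (K (\<omega> m)))"
      by (simp add: chain_step_def Suc fun_eq_iff)
    ultimately show ?thesis by simp
  qed
qed (simp add: chain_step_def prob_space_measure_pmf)

lemma sets_path_measure: "sets (path_measure K x) = sets (PiM UNIV (\<lambda>_. count_space UNIV))"
proof -
  interpret Ionescu_Tulcea "chain_step K x" "\<lambda>_. count_space UNIV"
    by (rule Ionescu_Tulcea_chain_step)
  show ?thesis by (simp add: path_measure_def)
qed

lemma space_path_measure: "space (path_measure K x) = UNIV"
proof -
  have "space (path_measure K x) = space (PiM UNIV (\<lambda>_. count_space UNIV))"
    by (rule sets_eq_imp_space_eq) (rule sets_path_measure)
  then show ?thesis by (simp add: space_PiM)
qed

lemma cylinder_sets: "PiE {0..<k} (\<lambda>i. {f i}) \<in> sets (PiM {0..<k} (\<lambda>_ :: nat. count_space UNIV))"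
  by (rule sets_PiM_I_finite) auto

lemma cyl_mem: "g \<in> PiE {0..<k} (\<lambda>i. {f i}) \<longleftrightarrow> g \<in> extensional {0..<k} \<and> (\<forall>i<k. g i = f i)" for k :: nat
  by (auto simp: PiE_iff)

lemma cyl_vim:
  assumes "\<omega> \<in> extensional {0..<k :: nat}"
  shows "fun_upd \<omega> k -` (PiE {0..<Suc k} (\<lambda>i. {f i})) =
            (if \<omega> \<in> PiE {0..<k} (\<lambda>i. {f i}) then {f k} else {})"
proof -
  have 1: "fun_upd \<omega> k y \<in> extensional {0..<Suc k}" for y
    using assms by (simp add: extensional_def)
  have "(\<forall>i<Suc k. (fun_upd \<omega> k y) i = f i) \<longleftrightarrow> y = f k \<and> (\<forall>i<k. \<omega> i = f i)" for y
    by (auto simp: less_Suc_eq)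
  then have "fun_upd \<omega> k y \<in> PiE {0..<Suc k} (\<lambda>i. {f i}) \<longleftrightarrow>
              y = f k \<and> \<omega> \<in> PiE {0..<k} (\<lambda>i. {f i})" for y
    unfolding cyl_mem using 1 assms by simp
  then show ?thesis by (simp add: set_eq_iff)
qed

lemma path_measure_cylinder:
  "emeasure (path_measure K x) {\<omega>. \<forall>i\<le>n. \<omega> i = f i} =
    (if f 0 = x then ennreal (\<Prod>i<n. pmf (K (f i)) (f (Suc i))) else 0)"
proof -
  let ?M = "\<lambda>_ :: nat. count_space (UNIV :: 'a set)"
  interpret Ionescu_Tulcea "chain_step K x" ?M
    by (rule Ionescu_Tulcea_chain_step)
  let ?cyl = "\<lambda>k. PiE {0..<k} (\<lambda>i. {f i})"
  define D where "D k = C 0 k (\<lambda>_. undefined)" for k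
  have undef: "(\<lambda>_. undefined) \<in> space (PiM {0..<0} ?M)"
    by (simp add: space_PiM)
  have setsD: "sets (D k) = sets (PiM {0..<k} ?M)" for k
    using sets_C[OF undef, of k] unfolding D_def by simp
  have spD: "space (D k) = space (PiM {0..<k} ?M)" for k
    by (rule sets_eq_imp_space_eq[OF setsD])
  have neD: "space (D k) \<noteq> {}" for k
    unfolding D_def by (rule prob_space.not_empty[OF prob_space_C[OF undef]])
  have D_Suc: "D (Suc k) = D k \<bind> eP k" for k
    by (simp add: D_def)
  have step: "emeasure (D (Suc k)) (?cyl (Suc k)) =
      emeasure (chain_step K x k f) {f k} * emeasure (D k) (?cyl k)" for k
  proof -
    have mE: "eP k \<in> measurable (D k) (subprob_algebra (PiM {0..<Suc k} ?M))"
      using measurable_eP[of k] by (simp only: measurable_cong_sets[OF setsD refl])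
    have eP: "emeasure (eP k \<omega>) (?cyl (Suc k)) =
        emeasure (chain_step K x k f) {f k} * indicator (?cyl k) \<omega>" if "\<omega> \<in> space (D k)" for \<omega>
    proof -
      have \<omega>: "\<omega> \<in> space (PiM {0..<k} ?M)"
        using that by (simp only: spD)
      have ext: "\<omega> \<in> extensional {0..<k}"
        using \<omega> by (simp add: space_PiM PiE_iff)
      have 1: "emeasure (eP k \<omega>) (?cyl (Suc k)) =
          emeasure (chain_step K x k \<omega>) (if \<omega> \<in> ?cyl k then {f k} else {})"
        using emeasure_eP[OF \<omega> cylinder_sets[of "Suc k" f]]
        by (simp only: cyl_vim[OF ext] space_count_space Int_UNIV_right)
      have 2: "chain_step K x k \<omega> = chain_step K x k f" if "\<omega> \<in> ?cyl k"
        using that by (cases k) (auto simp: chain_step_def cyl_mem)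
      show ?thesis
        unfolding 1 using 2 by (cases "\<omega> \<in> ?cyl k") simp_all
    qed
    have "emeasure (D (Suc k)) (?cyl (Suc k)) = (\<integral>\<^sup>+\<omega>. emeasure (eP k \<omega>) (?cyl (Suc k)) \<partial>D k)"
      unfolding D_Suc by (rule emeasure_bind[OF neD mE cylinder_sets])
    moreover have "(\<integral>\<^sup>+\<omega>. emeasure (eP k \<omega>) (?cyl (Suc k)) \<partial>D k) =
        (\<integral>\<^sup>+\<omega>. emeasure (chain_step K x k f) {f k} * indicator (?cyl k) \<omega> \<partial>D k)"
      by (rule nn_integral_cong) (rule eP)
    moreover have "\<dots> = emeasure (chain_step K x k f) {f k} * emeasure (D k) (?cyl k)"
      by (rule nn_integral_cmult_indicator) (simp only: setsD cylinder_sets)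
    ultimately show ?thesis by (simp only:)
  qed
  have D: "emeasure (D (Suc n)) (?cyl (Suc n)) =
      (if f 0 = x then ennreal (\<Prod>i<n. pmf (K (f i)) (f (Suc i))) else 0)" for n
  proof (induction n)
    case 0
    have "emeasure (D 0) (?cyl 0) = 1"
      using prob_space.emeasure_space_1[OF prob_space_C[OF undef, of 0]] spD[of 0]
      by (simp add: D_def space_PiM)
    then show ?case
      unfolding step[of 0] by (auto simp: chain_step_def emeasure_pmf_single pmf_return)
  next
    case (Suc n)
    have "emeasure (chain_step K x (Suc n) f) {f (Suc n)} = ennreal (pmf (K (f n)) (f (Suc n)))"
      by (simp add: chain_step_def emeasure_pmf_single)
    then show ?case
      unfolding step[of "Suc n"] Suc
      by (simp add: ennreal_mult[symmetric] prod_nonneg mult.commute)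
  qed
  have eq: "{\<omega>. \<forall>i\<le>n. \<omega> i = f i} = PF.emb UNIV {0..<Suc n} (?cyl (Suc n))"
    by (auto simp: prod_emb_def PiE_iff less_Suc_eq_le space_PiM)
  have emb: "PF.emb {0..<Suc n} {0..<Suc n} (?cyl (Suc n)) = ?cyl (Suc n)"
    by (rule prod_emb_id) (auto simp: PiE_iff)
  have "emeasure (path_measure K x) {\<omega>. \<forall>i\<le>n. \<omega> i = f i} = emeasure (CI {0..<Suc n}) (?cyl (Suc n))"
    unfolding eq path_measure_def by (rule lim) (simp_all add: cylinder_sets)
  moreover have "\<dots> = emeasure (D (Suc n)) (?cyl (Suc n))"
    using emeasure_CI[OF subset_refl cylinder_sets[of "Suc n" f]] unfolding emb D_def .
  ultimately show ?thesis
    using D[of n] by (simp only:)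
qed


section \<open>Random walks\<close>

inductive_set semigroup_generated :: "('a, 'b) monoid_scheme \<Rightarrow> 'a set \<Rightarrow> 'a set"
  for G and S where
    incl: "g \<in> S \<Longrightarrow> g \<in> semigroup_generated G S"
  | mult: "g \<in> semigroup_generated G S \<Longrightarrow> h \<in> semigroup_generated G S \<Longrightarrow>
      g \<otimes>\<^bsub>G\<^esub> h \<in> semigroup_generated G S"

text \<open>
  Used for countable groups, where probability measures are mass functions and
  \<open>set_pmf \<mu>\<close> is the support.
\<close>
definition strictly_nondegenerate :: "('a, 'b) monoid_scheme \<Rightarrow> 'a pmf \<Rightarrow> bool" where
  "strictly_nondegenerate G \<mu> \<longleftrightarrow> semigroup_generated G (set_pmf \<mu>) = carrier G"

text \<open>Pushing forward adds up the probabilities of all \<open>g\<close> with the same \<open>g \<gamma>\<close>.\<close>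
definition induced_walk :: "(real \<Rightarrow> real) pmf \<Rightarrow> real \<Rightarrow> real pmf" where
  "induced_walk \<mu> \<gamma> = map_pmf (\<lambda>g. g \<gamma>) \<mu>"

end

theory Submission
  imports Defs
begin

text \<open>
  The action preserves counting measure, so the transition operator \<open>P\<close> of the walk is doubly
  stochastic.  For \<open>u = (\<Sum>n<N. P\<^sup>n \<delta>\<^sub>z)\<close> this gives
  \<open>(\<Sum>g. \<mu> g * \<parallel>u \<circ> g - u\<parallel>\<^sup>2) = 2 * \<langle>u, u - P u\<rangle> \<le> 2 * u z\<close>
  even though \<open>P\<close> need not be reversible.  Since the support of \<open>\<mu>\<close> generates the group as a
  semigroup, \<open>\<parallel>u \<circ> g - u\<parallel>\<^sup>2\<close> is then at most a constant times \<open>u z\<close> for each fixed \<open>g\<close>.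

  On \<open>[0, 1)\<close> the maps \<open>y \<mapsto> y / 2\<close> and \<open>y \<mapsto> (y + 1) / 2\<close> are restrictions of group
  elements and generate a binary tree.  The averages of \<open>u\<close> over the levels
  \<open>{(x + k) / 2\<^sup>n | k < 2\<^sup>n}\<close> tend to \<open>0\<close>, and by Cauchy-Schwarz consecutive averages
  differ by at most \<open>2 powr (- n / 2)\<close> times the displacement of \<open>u\<close> under these two elements.
  Telescoping, \<open>(u x)\<^sup>2\<close> is at most a constant times \<open>u z\<close> for every \<open>x\<close>.  Taking \<open>x = z\<close>
  bounds \<open>u z\<close> independently of \<open>N\<close>, so all Green functions are finite.
\<close>

section \<open>Displacements of square-summable functions\<close>

definition displacement :: "('a \<Rightarrow> 'a) \<Rightarrow> ('a \<Rightarrow> real) \<Rightarrow> ennreal" where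
  "displacement g f = (\<integral>\<^sup>+y. ennreal ((f (g y) - f y)\<^sup>2) \<partial>count_space UNIV)"

lemma square_diff_triangle: "(a - c)\<^sup>2 \<le> 2 * (a - b)\<^sup>2 + 2 * (b - c)\<^sup>2" for a b c :: real
proof -
  have "2 * (a - b)\<^sup>2 + 2 * (b - c)\<^sup>2 - (a - c)\<^sup>2 = (a - 2 * b + c)\<^sup>2"
    by (simp add: power2_eq_square algebra_simps)
  then show ?thesis
    using zero_le_power2[of "a - 2 * b + c"] by linarith
qed

lemma displacement_comp:
  assumes "bij g"
  shows "displacement (h \<circ> g) f \<le> 2 * displacement g f + 2 * displacement h f"
proof -
  have "displacement (h \<circ> g) f \<le>
      (\<integral>\<^sup>+y. 2 * ennreal ((f (h (g y)) - f (g y))\<^sup>2) + 2 * ennreal ((f (g y) - f y)\<^sup>2) \<partial>count_space UNIV)"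
    unfolding displacement_def
  proof (rule nn_integral_mono)
    fix y
    have "ennreal ((f ((h \<circ> g) y) - f y)\<^sup>2) \<le>
        ennreal (2 * (f (h (g y)) - f (g y))\<^sup>2 + 2 * (f (g y) - f y)\<^sup>2)"
      by (rule ennreal_leI) (simp add: square_diff_triangle)
    then show "ennreal ((f ((h \<circ> g) y) - f y)\<^sup>2) \<le>
        2 * ennreal ((f (h (g y)) - f (g y))\<^sup>2) + 2 * ennreal ((f (g y) - f y)\<^sup>2)"
      by (simp add: ennreal_plus ennreal_mult)
  qed
  also have "\<dots> = 2 * (\<integral>\<^sup>+y. ennreal ((f (h (g y)) - f (g y))\<^sup>2) \<partial>count_space UNIV) + 2 * displacement g f"
    unfolding displacement_def by (simp add: nn_integral_add nn_integral_cmult)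
  also have "(\<integral>\<^sup>+y. ennreal ((f (h (g y)) - f (g y))\<^sup>2) \<partial>count_space UNIV) = displacement h f"
    unfolding displacement_def
    using nn_integral_bij_count_space[OF assms, of "\<lambda>y. ennreal ((f (h y) - f y)\<^sup>2)"] .
  finally show ?thesis
    by (simp only: add.commute)
qed

lemma displacement_inverse:
  assumes "bij g" "\<And>y. h (g y) = y"
  shows "displacement h f = displacement g f"
proof -
  have "displacement h f = (\<integral>\<^sup>+y. ennreal ((f (h (g y)) - f (g y))\<^sup>2) \<partial>count_space UNIV)"
    unfolding displacement_def
    using nn_integral_bij_count_space[OF assms(1), of "\<lambda>y. ennreal ((f (h y) - f y)\<^sup>2)"] by simp
  then show ?thesis
    by (simp add: displacement_def assms(2) power2_commute)
qed

lemma square_le_displacement: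
  "ennreal ((f y)\<^sup>2) \<le> 2 * ennreal ((f (g y))\<^sup>2) + 2 * displacement g f"
  "ennreal ((f (g y))\<^sup>2) \<le> 2 * ennreal ((f y)\<^sup>2) + 2 * displacement g f"
proof -
  have D: "ennreal ((f (g y) - f y)\<^sup>2) \<le> displacement g f"
    unfolding displacement_def by (rule nn_integral_ge_point) simp
  have "(f y)\<^sup>2 \<le> 2 * (f (g y))\<^sup>2 + 2 * (f (g y) - f y)\<^sup>2"
    using square_diff_triangle[of "f y" 0 "f (g y)"] by (simp add: power2_commute)
  then have "ennreal ((f y)\<^sup>2) \<le> ennreal (2 * (f (g y))\<^sup>2 + 2 * (f (g y) - f y)\<^sup>2)"
    by (rule ennreal_leI)
  also have "\<dots> = 2 * ennreal ((f (g y))\<^sup>2) + 2 * ennreal ((f (g y) - f y)\<^sup>2)"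
    by (simp add: ennreal_plus ennreal_mult)
  finally show "ennreal ((f y)\<^sup>2) \<le> 2 * ennreal ((f (g y))\<^sup>2) + 2 * displacement g f"
    using D by (meson add_left_mono mult_left_mono order_trans zero_le)
  have "(f (g y))\<^sup>2 \<le> 2 * (f y)\<^sup>2 + 2 * (f (g y) - f y)\<^sup>2"
    using square_diff_triangle[of "f (g y)" 0 "f y"] by simp
  then have "ennreal ((f (g y))\<^sup>2) \<le> ennreal (2 * (f y)\<^sup>2 + 2 * (f (g y) - f y)\<^sup>2)"
    by (rule ennreal_leI)
  also have "\<dots> = 2 * ennreal ((f y)\<^sup>2) + 2 * ennreal ((f (g y) - f y)\<^sup>2)"
    by (simp add: ennreal_plus ennreal_mult)
  finally show "ennreal ((f (g y))\<^sup>2) \<le> 2 * ennreal ((f y)\<^sup>2) + 2 * displacement g f"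
    using D by (meson add_left_mono mult_left_mono order_trans zero_le)
qed


section \<open>The binary tree in the Schreier graph\<close>

lemma sum_lessThan_double: "sum h {..<2 * n} = sum h {..<n} + (\<Sum>k<n. h (k + n))" for n :: nat
proof -
  have "sum h {..<n + m} = sum h {..<n} + (\<Sum>k<m. h (k + n))" for m
    by (induction m) (simp_all add: add.commute add.left_commute)
  from this[of n] show ?thesis by (simp add: mult_2)
qed

lemma binary_tree_bound:
  fixes f :: "real \<Rightarrow> real"
  assumes x: "0 \<le> x" "x < 1"
    and square_sum: "\<And>T. finite T \<Longrightarrow> (\<Sum>y\<in>T. (f y)\<^sup>2) \<le> M"
    and left: "\<And>T. finite T \<Longrightarrow> T \<subseteq> {0..<1} \<Longrightarrow> (\<Sum>y\<in>T. (f (y / 2) - f y)\<^sup>2) \<le> d"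
    and right: "\<And>T. finite T \<Longrightarrow> T \<subseteq> {0..<1} \<Longrightarrow> (\<Sum>y\<in>T. (f ((y + 1) / 2) - f y)\<^sup>2) \<le> d"
  shows "(f x)\<^sup>2 \<le> 16 * d"
proof -
  define y where "y n k = (x + real k) / 2 ^ n" for n k :: nat
  define m where "m n = (\<Sum>k<2 ^ n. f (y n k)) / 2 ^ n" for n
  have inj: "inj_on (y n) {..<2 ^ n}" for n
    by (auto simp: inj_on_def y_def)
  have range: "y n ` {..<2 ^ n} \<subseteq> {0..<1}" for n
  proof safe
    fix k :: nat assume "k < 2 ^ n"
    then have "k + 1 \<le> 2 ^ n" by simp
    then have "real k + 1 \<le> 2 ^ n"
      by (metis of_nat_1 of_nat_add of_nat_le_iff of_nat_numeral of_nat_power)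
    then show "y n k \<in> {0..<1}"
      using x by (simp add: y_def)
  qed
  have level: "(\<Sum>k<2 ^ n. h (y n k)) = (\<Sum>z\<in>y n ` {..<2 ^ n}. h z)" for n and h :: "real \<Rightarrow> real"
    by (simp add: sum.reindex[OF inj])
  have d0: "0 \<le> d" using left[of "{}"] by simp
  have mean_square: "((\<Sum>k<2 ^ n. a k) / 2 ^ n)\<^sup>2 \<le> (\<Sum>k<2 ^ n. (a k)\<^sup>2) / 2 ^ n" for n and a :: "nat \<Rightarrow> real"
    using sum_squared_le_sum_of_squares[of a "{..<2 ^ n}"]
    by (simp add: power_divide field_simps power2_eq_square)
  have step: "\<bar>m n - m (Suc n)\<bar> \<le> sqrt d * (3 / 4) ^ n" for n
  proof -
    have children: "y (Suc n) k = y n k / 2" "y n (k + 2 ^ n) = y n k + 1" for k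
      by (simp_all add: y_def field_simps)
    have "m (Suc n) = ((\<Sum>k<2 ^ n. f (y n k / 2)) + (\<Sum>k<2 ^ n. f ((y n k + 1) / 2))) / 2 ^ Suc n"
      unfolding m_def power_Suc[of "2 :: nat"] sum_lessThan_double by (simp add: children)
    then have "m n - m (Suc n) =
        (\<Sum>k<2 ^ n. f (y n k) - (f (y n k / 2) + f ((y n k + 1) / 2)) / 2) / 2 ^ n"
      by (simp add: m_def sum_subtractf sum.distrib sum_divide_distrib[symmetric] diff_divide_distrib add_divide_distrib)
    then have "(m n - m (Suc n))\<^sup>2 \<le>
        (\<Sum>k<2 ^ n. (f (y n k) - (f (y n k / 2) + f ((y n k + 1) / 2)) / 2)\<^sup>2) / 2 ^ n"
      by (simp only: mean_square)
    also have "\<dots> \<le> (\<Sum>k<2 ^ n. (f (y n k / 2) - f (y n k))\<^sup>2 / 2 + (f ((y n k + 1) / 2) - f (y n k))\<^sup>2 / 2) / 2 ^ n"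
    proof (intro divide_right_mono sum_mono)
      fix k
      have "(a - (b + c) / 2)\<^sup>2 \<le> (b - a)\<^sup>2 / 2 + (c - a)\<^sup>2 / 2" for a b c :: real
        using zero_le_power2[of "b - c"] by (simp add: power2_eq_square field_simps)
      then show "(f (y n k) - (f (y n k / 2) + f ((y n k + 1) / 2)) / 2)\<^sup>2 \<le>
          (f (y n k / 2) - f (y n k))\<^sup>2 / 2 + (f ((y n k + 1) / 2) - f (y n k))\<^sup>2 / 2" .
    qed simp
    also have "\<dots> = ((\<Sum>k<2 ^ n. (f (y n k / 2) - f (y n k))\<^sup>2) +
        (\<Sum>k<2 ^ n. (f ((y n k + 1) / 2) - f (y n k))\<^sup>2)) / 2 / 2 ^ n"
      by (simp add: sum.distrib sum_divide_distrib add_divide_distrib)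
    also have "\<dots> \<le> (d + d) / 2 / 2 ^ n"
      using left[OF _ range] right[OF _ range]
      unfolding level[of "\<lambda>z. (f (z / 2) - f z)\<^sup>2"] level[of "\<lambda>z. (f ((z + 1) / 2) - f z)\<^sup>2"]
      by (intro divide_right_mono add_mono) auto
    also have "\<dots> = d * (1 / 2) ^ n"
      by (simp add: power_divide)
    \<comment> \<open>Weakening the rate \<open>sqrt (1 / 2)\<close> to \<open>3 / 4\<close> keeps the geometric sum rational.\<close>
    also have "\<dots> \<le> d * (9 / 16) ^ n"
      by (intro mult_left_mono power_mono d0) auto
    also have "(9 / 16 :: real) ^ n = ((3 / 4) ^ n)\<^sup>2"
      by (simp add: power2_eq_square flip: power_mult_distrib)
    finally have "\<bar>m n - m (Suc n)\<bar> \<le> sqrt (d * ((3 / 4) ^ n)\<^sup>2)"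
      using real_sqrt_le_mono by fastforce
    then show ?thesis
      by (simp add: real_sqrt_mult)
  qed
  have far: "\<bar>m 0 - m n\<bar> \<le> 4 * sqrt d * (1 - (3 / 4) ^ n)" for n
  proof (induction n)
    case (Suc n)
    then show ?case
      using step[of n] by (simp add: algebra_simps)
  qed simp
  have "m \<longlonglongrightarrow> 0"
  proof -
    have "(m n)\<^sup>2 \<le> M * (1 / 2) ^ n" for n
    proof -
      have "(m n)\<^sup>2 \<le> (\<Sum>k<2 ^ n. (f (y n k))\<^sup>2) / 2 ^ n"
        unfolding m_def by (rule mean_square)
      also have "\<dots> \<le> M / 2 ^ n"
        unfolding level[of "\<lambda>z. (f z)\<^sup>2"] by (intro divide_right_mono square_sum) auto
      finally show ?thesis by (simp add: power_divide)
    qed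
    moreover have "(\<lambda>n. M * (1 / 2) ^ n) \<longlonglongrightarrow> 0"
      by (rule tendsto_mult_right_zero) (simp add: LIMSEQ_power_zero)
    ultimately have "(\<lambda>n. (m n)\<^sup>2) \<longlonglongrightarrow> 0"
      by (intro tendsto_sandwich[of "\<lambda>_. 0" "\<lambda>n. (m n)\<^sup>2" sequentially "\<lambda>n. M * (1 / 2) ^ n"]) auto
    then show ?thesis
      by simp
  qed
  then have lim: "(\<lambda>n. \<bar>m 0 - m n\<bar>) \<longlonglongrightarrow> \<bar>m 0 - 0\<bar>"
    by (intro tendsto_intros)
  have "\<bar>m 0 - m n\<bar> \<le> 4 * sqrt d" for n
  proof -
    have "4 * sqrt d * (1 - (3 / 4) ^ n) \<le> 4 * sqrt d * 1"
      using d0 by (intro mult_left_mono) auto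
    then show ?thesis using far[of n] by simp
  qed
  then have "\<bar>m 0 - 0\<bar> \<le> 4 * sqrt d"
    by (intro LIMSEQ_le_const2[OF lim]) auto
  then have "\<bar>f x\<bar> \<le> 4 * sqrt d"
    by (simp add: m_def y_def)
  then have "\<bar>f x\<bar>\<^sup>2 \<le> (4 * sqrt d)\<^sup>2"
    by (intro power_mono) auto
  then show ?thesis
    using d0 by (simp add: power_mult_distrib)
qed

lemma sum_le_nn_integral_count_space:
  fixes h :: "'a \<Rightarrow> real"
  assumes "finite T" "\<And>y. 0 \<le> h y" "\<And>y. y \<in> T \<Longrightarrow> h y = k y"
    and "(\<integral>\<^sup>+y. ennreal (k y) \<partial>count_space UNIV) \<le> ennreal c" "0 \<le> c"
  shows "(\<Sum>y\<in>T. h y) \<le> c"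
proof -
  have "ennreal (\<Sum>y\<in>T. h y) = (\<Sum>y\<in>T. ennreal (h y))"
    using assms(2) by (simp add: sum_ennreal)
  also have "\<dots> = (\<Sum>y\<in>T. ennreal (k y))"
    by (simp add: assms(3))
  also have "\<dots> = (\<integral>\<^sup>+y. ennreal (k y) \<partial>count_space T)"
    by (rule nn_integral_count_space_finite[OF assms(1), symmetric])
  also have "\<dots> \<le> (\<integral>\<^sup>+y. ennreal (k y) \<partial>count_space UNIV)"
    by (subst nn_integral_count_space_indicator) (auto simp: indicator_def intro!: nn_integral_mono)
  also note assms(4)
  finally show ?thesis
    using assms(5) by simp
qed

lemma square_le_displacement_generators:
  assumes x: "0 \<le> x" "x < 1"
    and fin: "(\<integral>\<^sup>+y. ennreal ((f y)\<^sup>2) \<partial>count_space UNIV) < \<top>"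
  shows "ennreal ((f x)\<^sup>2) \<le> 48 * displacement A_map f + 48 * displacement B_map f"
proof -
  define S :: "real \<Rightarrow> real" where "S y = y + 1" for y
  have bij_A: "bij A_map" and bij_S: "bij S"
    by (rule bij_betw_byWitness[where f' = "\<lambda>y. y + 1"]; simp add: A_map_def)
       (rule bij_betw_byWitness[where f' = "\<lambda>y. y - 1"]; simp add: S_def)
  define D where "D = displacement B_map f + displacement (B_map \<circ> S) f"
  have D_le: "D \<le> 3 * displacement A_map f + 3 * displacement B_map f"
  proof -
    have "displacement S f = displacement A_map f"
      by (rule displacement_inverse[OF bij_A]) (simp add: S_def A_map_def)
    then have "D \<le> displacement B_map f + (2 * displacement A_map f + 2 * displacement B_map f)"
      unfolding D_def using displacement_comp[OF bij_S, of B_map f] by (intro add_left_mono) simp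
    also have "\<dots> = 2 * displacement A_map f + 3 * displacement B_map f"
      using distrib_right[of 1 2 "displacement B_map f"] by (simp add: add.left_commute)
    also have "\<dots> \<le> 3 * displacement A_map f + 3 * displacement B_map f"
      by (intro add_right_mono mult_right_mono) auto
    finally show ?thesis .
  qed
  have "ennreal ((f x)\<^sup>2) \<le> 16 * D"
  proof (cases "D = \<top>")
    case True
    then show ?thesis by (simp add: ennreal_mult_top)
  next
    case False
    define d where "d = enn2real D"
    have d: "D = ennreal d" "0 \<le> d"
      using False by (simp_all add: d_def less_top)
    obtain M where M: "(\<integral>\<^sup>+y. ennreal ((f y)\<^sup>2) \<partial>count_space UNIV) = ennreal M" "0 \<le> M"
      using fin by (metis ennreal_cases less_irrefl)
    have le: "displacement B_map f \<le> ennreal d" "displacement (B_map \<circ> S) f \<le> ennreal d"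
      unfolding d(1)[symmetric] D_def by simp_all
    have "(f x)\<^sup>2 \<le> 16 * d"
    proof (rule binary_tree_bound[OF x])
      show "(\<Sum>y\<in>T. (f y)\<^sup>2) \<le> M" if "finite T" for T
        using that M by (intro sum_le_nn_integral_count_space[of T _ "\<lambda>y. (f y)\<^sup>2"]) auto
      show "(\<Sum>y\<in>T. (f (y / 2) - f y)\<^sup>2) \<le> d" if "finite T" "T \<subseteq> {0..<1}" for T
      proof (rule sum_le_nn_integral_count_space[OF that(1)])
        show "(f (y / 2) - f y)\<^sup>2 = (f (B_map y) - f y)\<^sup>2" if "y \<in> T" for y
        proof -
          have B: "B_map y = y / 2"
            using that \<open>T \<subseteq> {0..<1}\<close> by (force simp: B_map_def)
          show ?thesis by (simp add: B)
        qed
      qed (use le d in \<open>auto simp: displacement_def\<close>)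
      show "(\<Sum>y\<in>T. (f ((y + 1) / 2) - f y)\<^sup>2) \<le> d" if "finite T" "T \<subseteq> {0..<1}" for T
      proof (rule sum_le_nn_integral_count_space[OF that(1)])
        show "(f ((y + 1) / 2) - f y)\<^sup>2 = (f ((B_map \<circ> S) y) - f y)\<^sup>2" if "y \<in> T" for y
        proof -
          have B: "B_map (S y) = (y + 1) / 2"
            using that \<open>T \<subseteq> {0..<1}\<close> by (force simp: B_map_def S_def)
          show ?thesis by (simp add: B)
        qed
      qed (use le d in \<open>auto simp: displacement_def\<close>)
    qed
    then have "ennreal ((f x)\<^sup>2) \<le> ennreal (16 * d)"
      by (rule ennreal_leI)
    then show ?thesis
      using d by (simp add: ennreal_mult)
  qed
  also have "\<dots> \<le> 16 * (3 * displacement A_map f + 3 * displacement B_map f)"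
    by (intro mult_left_mono D_le) simp
  finally show ?thesis
    by (simp add: distrib_left flip: mult.assoc)
qed

lemma square_le_displacement_generators_all:
  fixes x :: real
  shows "\<exists>C<\<top>. \<forall>f. (\<integral>\<^sup>+y. ennreal ((f y)\<^sup>2) \<partial>count_space UNIV) < \<top> \<longrightarrow>
    ennreal ((f x)\<^sup>2) \<le> C * (displacement A_map f + displacement B_map f)"
    (is "?P x")
proof -
  have shift: "?P z'" if z: "?P z"
    and le: "\<And>f. ennreal ((f z')\<^sup>2) \<le> 2 * ennreal ((f z)\<^sup>2) + 2 * displacement A_map f" for z z' :: real
  proof -
    obtain C where C: "C < \<top>"
      "\<And>f. (\<integral>\<^sup>+y. ennreal ((f y)\<^sup>2) \<partial>count_space UNIV) < \<top> \<Longrightarrow>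
        ennreal ((f z)\<^sup>2) \<le> C * (displacement A_map f + displacement B_map f)"
      using z by blast
    have "ennreal ((f z')\<^sup>2) \<le> (2 * C + 2) * (displacement A_map f + displacement B_map f)"
      if "(\<integral>\<^sup>+y. ennreal ((f y)\<^sup>2) \<partial>count_space UNIV) < \<top>" for f
    proof -
      have "ennreal ((f z')\<^sup>2) \<le> 2 * ennreal ((f z)\<^sup>2) + 2 * displacement A_map f"
        by (rule le)
      also have "\<dots> \<le> 2 * (C * (displacement A_map f + displacement B_map f)) +
          2 * (displacement A_map f + displacement B_map f)"
        using C(2)[OF that] by (intro add_mono mult_left_mono) auto
      finally show ?thesis by (simp add: algebra_simps)
    qed
    then show ?thesis
      using C(1) by (intro exI[of _ "2 * C + 2"]) (auto simp: ennreal_mult_less_top)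
  qed
  have "?P (frac x + of_int i)" for i
  proof (induction i rule: int_induct[where k = 0])
    case base
    have "ennreal ((f (frac x))\<^sup>2) \<le> 48 * (displacement A_map f + displacement B_map f)"
      if "(\<integral>\<^sup>+y. ennreal ((f y)\<^sup>2) \<partial>count_space UNIV) < \<top>" for f
      using square_le_displacement_generators[OF frac_ge_0 frac_lt_1 that] by (simp add: distrib_left)
    then show ?case
      by (intro exI[of _ 48]) auto
  next
    case (step1 i)
    have "A_map (frac x + of_int (i + 1)) = frac x + of_int i"
      by (simp add: A_map_def)
    then show ?case
      using square_le_displacement(1)[of _ "frac x + of_int (i + 1)" A_map]
      by (intro shift[OF step1(2)]) simp
  next
    case (step2 i)
    have "A_map (frac x + of_int i) = frac x + of_int (i - 1)"
      by (simp add: A_map_def)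
    then show ?case
      using square_le_displacement(2)[of _ A_map "frac x + of_int i"]
      by (intro shift[OF step2(2)]) simp
  qed
  from this[of "\<lfloor>x\<rfloor>"] show ?thesis
    by (simp add: frac_def)
qed


section \<open>Green functions of measure-preserving walks\<close>

definition pmf_operator :: "('a \<Rightarrow> 'a pmf) \<Rightarrow> ('a \<Rightarrow> ennreal) \<Rightarrow> 'a \<Rightarrow> ennreal" where
  "pmf_operator K h y = (\<integral>\<^sup>+w. h w \<partial>measure_pmf (K y))"

definition partial_green :: "('a \<Rightarrow> 'a pmf) \<Rightarrow> 'a \<Rightarrow> nat \<Rightarrow> 'a \<Rightarrow> ennreal" where
  "partial_green K z N y = (\<Sum>n<N. (pmf_operator K ^^ n) (indicator {z}) y)"

lemma partial_green_le_step:
  "partial_green K z N y \<le> indicator {z} y + pmf_operator K (partial_green K z N) y"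
proof -
  have "partial_green K z N y \<le> partial_green K z (Suc N) y"
    by (simp add: partial_green_def)
  also have "\<dots> = indicator {z} y + (\<Sum>n<N. pmf_operator K ((pmf_operator K ^^ n) (indicator {z})) y)"
    unfolding partial_green_def sum.lessThan_Suc_shift by simp
  also have "(\<Sum>n<N. pmf_operator K ((pmf_operator K ^^ n) (indicator {z})) y) =
      pmf_operator K (partial_green K z N) y"
    unfolding partial_green_def pmf_operator_def[of K] by (simp add: nn_integral_sum)
  finally show ?thesis .
qed

lemma pmf_operator_power_le_1: "(pmf_operator K ^^ n) (indicator {z}) y \<le> 1"
proof (induction n arbitrary: y)
  case (Suc n)
  have "(pmf_operator K ^^ Suc n) (indicator {z}) y \<le> (\<integral>\<^sup>+w. 1 \<partial>measure_pmf (K y))"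
    unfolding funpow.simps comp_def pmf_operator_def[of K "(pmf_operator K ^^ n) (indicator {z})"]
    by (rule nn_integral_mono) (rule Suc)
  then show ?case by simp
qed (simp add: indicator_def)

lemma partial_green_le: "partial_green K z N y \<le> of_nat N"
proof -
  have "partial_green K z N y \<le> (\<Sum>n<N. 1)"
    unfolding partial_green_def by (rule sum_mono) (rule pmf_operator_power_le_1)
  then show ?thesis by simp
qed

lemma nn_integral_pmf_count_space_commute:
  "(\<integral>\<^sup>+y. (\<integral>\<^sup>+g. F g y \<partial>measure_pmf p) \<partial>count_space UNIV) =
   (\<integral>\<^sup>+g. (\<integral>\<^sup>+y. F g y \<partial>count_space UNIV) \<partial>measure_pmf p)"
proof -
  define H where "H = (\<lambda>(g, y). ennreal (pmf p g) * F g y)"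
  have "(\<integral>\<^sup>+y. (\<integral>\<^sup>+g. F g y \<partial>measure_pmf p) \<partial>count_space UNIV) =
      (\<integral>\<^sup>+y. \<integral>\<^sup>+g. H (g, y) \<partial>count_space UNIV \<partial>count_space UNIV)"
    by (simp add: nn_integral_measure_pmf H_def)
  also have "\<dots> = (\<integral>\<^sup>+g. \<integral>\<^sup>+y. H (g, y) \<partial>count_space UNIV \<partial>count_space UNIV)"
    by (simp only: nn_integral_fst_count_space nn_integral_snd_count_space)
  finally show ?thesis
    by (simp add: nn_integral_measure_pmf H_def nn_integral_cmult)
qed

locale bijection_walk =
  fixes \<mu> :: "('a \<Rightarrow> 'a) pmf" and K :: "'a \<Rightarrow> 'a pmf"
  assumes bij: "\<And>g. g \<in> set_pmf \<mu> \<Longrightarrow> bij g"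
  defines "K \<equiv> \<lambda>y. map_pmf (\<lambda>g. g y) \<mu>"
begin

definition energy :: "('a \<Rightarrow> real) \<Rightarrow> ennreal" where
  "energy f = (\<integral>\<^sup>+g. displacement g f \<partial>measure_pmf \<mu>)"

lemma pmf_operator_eq: "pmf_operator K h y = (\<integral>\<^sup>+g. h (g y) \<partial>measure_pmf \<mu>)"
  by (simp add: pmf_operator_def K_def)

lemma nn_integral_pmf_operator:
  "(\<integral>\<^sup>+y. pmf_operator K h y \<partial>count_space UNIV) = (\<integral>\<^sup>+y. h y \<partial>count_space UNIV)"
proof -
  have "(\<integral>\<^sup>+y. pmf_operator K h y \<partial>count_space UNIV) =
      (\<integral>\<^sup>+g. (\<integral>\<^sup>+y. h (g y) \<partial>count_space UNIV) \<partial>measure_pmf \<mu>)"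
    by (simp add: pmf_operator_eq nn_integral_pmf_count_space_commute)
  also have "\<dots> = (\<integral>\<^sup>+g. (\<integral>\<^sup>+y. h y \<partial>count_space UNIV) \<partial>measure_pmf \<mu>)"
    by (rule nn_integral_cong_AE) (auto simp: AE_measure_pmf_iff intro!: nn_integral_bij_count_space bij)
  finally show ?thesis by simp
qed

lemma nn_integral_partial_green: "(\<integral>\<^sup>+y. partial_green K z N y \<partial>count_space UNIV) = of_nat N"
proof -
  have "(\<integral>\<^sup>+y. (pmf_operator K ^^ n) (indicator {z}) y \<partial>count_space UNIV) = 1" for n
    by (induction n) (simp_all add: nn_integral_pmf_operator)
  then show ?thesis
    unfolding partial_green_def by (simp add: nn_integral_sum)
qed

lemma nn_integral_partial_green_square:
  "(\<integral>\<^sup>+y. (partial_green K z N y)\<^sup>2 \<partial>count_space UNIV) < \<top>"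
proof -
  have "(\<integral>\<^sup>+y. (partial_green K z N y)\<^sup>2 \<partial>count_space UNIV) \<le>
      (\<integral>\<^sup>+y. of_nat N * partial_green K z N y \<partial>count_space UNIV)"
    unfolding power2_eq_square by (intro nn_integral_mono mult_right_mono partial_green_le) simp
  also have "\<dots> = of_nat N * of_nat N"
    by (simp add: nn_integral_cmult nn_integral_partial_green)
  also have "\<dots> < \<top>"
    by (simp add: ennreal_mult_less_top of_nat_less_top)
  finally show ?thesis .
qed

lemma energy_partial_green:
  "energy (\<lambda>y. enn2real (partial_green K z N y)) \<le> 2 * partial_green K z N z"
proof -
  define u where "u = partial_green K z N"
  define f where "f y = enn2real (u y)" for y
  define Q where "Q = (\<integral>\<^sup>+y. u y * pmf_operator K u y \<partial>count_space UNIV)"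
  define S where "S = (\<integral>\<^sup>+y. (u y)\<^sup>2 \<partial>count_space UNIV)"
  have u: "u y = ennreal (f y)" for y
    using partial_green_le[of K z N y] unfolding f_def u_def
    by (metis ennreal_enn2real ennreal_of_nat_eq_real_of_nat ennreal_less_top le_less_trans)
  have f0: "0 \<le> f y" for y
    by (simp add: f_def)
  have expand: "ennreal ((f (g y) - f y)\<^sup>2) + 2 * (u y * u (g y)) = (u (g y))\<^sup>2 + (u y)\<^sup>2" for g y
  proof -
    have "ennreal ((f (g y) - f y)\<^sup>2) + 2 * (u y * u (g y)) =
        ennreal ((f (g y) - f y)\<^sup>2 + 2 * (f y * f (g y)))"
      using f0 by (simp add: u ennreal_plus ennreal_mult)
    also have "(f (g y) - f y)\<^sup>2 + 2 * (f y * f (g y)) = (f (g y))\<^sup>2 + (f y)\<^sup>2"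
      by (simp add: power2_eq_square algebra_simps)
    finally show ?thesis
      using f0 by (simp add: u ennreal_plus ennreal_power)
  qed
  have "energy f + 2 * Q =
      (\<integral>\<^sup>+y. (\<integral>\<^sup>+g. ennreal ((f (g y) - f y)\<^sup>2) + 2 * (u y * u (g y)) \<partial>measure_pmf \<mu>) \<partial>count_space UNIV)"
    by (simp add: energy_def displacement_def Q_def pmf_operator_eq nn_integral_add nn_integral_cmult
        nn_integral_pmf_count_space_commute[symmetric])
  also have "\<dots> = (\<integral>\<^sup>+y. pmf_operator K (\<lambda>y. (u y)\<^sup>2) y + (u y)\<^sup>2 \<partial>count_space UNIV)"
    unfolding expand by (simp add: pmf_operator_eq nn_integral_add)
  also have "\<dots> = 2 * S"
    by (simp add: nn_integral_add nn_integral_pmf_operator S_def mult_2)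
  finally have eq: "energy f + 2 * Q = 2 * S" .
  have "S \<le> (\<integral>\<^sup>+y. u y * indicator {z} y + u y * pmf_operator K u y \<partial>count_space UNIV)"
    unfolding S_def power2_eq_square distrib_left[symmetric] u_def
    by (intro nn_integral_mono mult_left_mono partial_green_le_step) simp
  also have "\<dots> = u z + Q"
    by (simp add: nn_integral_add Q_def)
  finally have "energy f + 2 * Q \<le> 2 * u z + 2 * Q"
    unfolding eq using mult_left_mono[of S "u z + Q" 2] by (simp add: distrib_left)
  moreover have "2 * Q < \<top>"
  proof -
    have "2 * Q \<le> 2 * S" unfolding eq[symmetric] by simp
    also have "\<dots> < \<top>"
      using nn_integral_partial_green_square[of z N] by (simp add: S_def u_def ennreal_mult_less_top)
    finally show ?thesis .
  qed
  ultimately have "energy f \<le> 2 * u z"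
    using ennreal_add_left_cancel_le[of "2 * Q" "energy f" "2 * u z"]
    by (simp only: add.commute[of "2 * Q"]) auto
  then show ?thesis
    by (simp add: f_def[abs_def] u_def)
qed

lemma displacement_le_energy:
  assumes "g \<in> set_pmf \<mu>"
  shows "displacement g f \<le> ennreal (1 / pmf \<mu> g) * energy f"
proof -
  have p: "0 < pmf \<mu> g"
    using assms by (simp add: pmf_positive)
  have "ennreal (pmf \<mu> g) * displacement g f \<le> energy f"
    unfolding energy_def nn_integral_measure_pmf by (rule nn_integral_ge_point) simp
  then have "ennreal (1 / pmf \<mu> g) * (ennreal (pmf \<mu> g) * displacement g f) \<le> ennreal (1 / pmf \<mu> g) * energy f"
    by (rule mult_left_mono) simp
  then show ?thesis
    using p by (simp add: ennreal_mult[symmetric] flip: mult.assoc)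
qed

end


section \<open>From finite Green functions to transience\<close>

lemma emeasure_path_measure_coordinate:
  "emeasure (path_measure K x) {\<omega>. \<omega> n = z} = (pmf_operator K ^^ n) (indicator {z}) x"
proof -
  let ?M = "\<lambda>_ :: nat. count_space (UNIV :: 'a set)"
  interpret Ionescu_Tulcea "chain_step K x" ?M
    by (rule Ionescu_Tulcea_chain_step)
  define D where "D k = C 0 k (\<lambda>_. undefined)" for k
  have undef: "(\<lambda>_. undefined) \<in> space (PiM {0..<0} ?M)"
    by (simp add: space_PiM)
  have setsD: "sets (D k) = sets (PiM {0..<k} ?M)" for k
    using sets_C[OF undef, of k] unfolding D_def by simp
  have spD: "space (D k) = space (PiM {0..<k} ?M)" for k
    by (rule sets_eq_imp_space_eq[OF setsD])
  have coord: "(\<lambda>\<omega>. h (\<omega> k)) \<in> borel_measurable (PiM {0..<Suc k} ?M)" for h :: "'a \<Rightarrow> ennreal" and k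
    by (rule measurable_compose[OF measurable_component_singleton]) auto
  have step: "(\<integral>\<^sup>+\<omega>. h (\<omega> k) \<partial>D (Suc k)) = (\<integral>\<^sup>+\<omega>. (\<integral>\<^sup>+w. h w \<partial>chain_step K x k \<omega>) \<partial>D k)"
    for h :: "'a \<Rightarrow> ennreal" and k
  proof -
    have mE: "eP k \<in> measurable (D k) (subprob_algebra (PiM {0..<Suc k} ?M))"
      using measurable_eP[of k] by (simp only: measurable_cong_sets[OF setsD refl])
    have "(\<integral>\<^sup>+\<omega>. h (\<omega> k) \<partial>D (Suc k)) = (\<integral>\<^sup>+\<omega>. (\<integral>\<^sup>+\<omega>'. h (\<omega>' k) \<partial>eP k \<omega>) \<partial>D k)"
      using nn_integral_bind[OF coord mE, of h] by (simp add: D_def)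
    also have "\<dots> = (\<integral>\<^sup>+\<omega>. (\<integral>\<^sup>+w. h w \<partial>chain_step K x k \<omega>) \<partial>D k)"
      by (rule nn_integral_cong) (simp add: spD nn_integral_eP coord)
    finally show ?thesis .
  qed
  have law: "(\<integral>\<^sup>+\<omega>. h (\<omega> n) \<partial>D (Suc n)) = (pmf_operator K ^^ n) h x" for h n
  proof (induction n arbitrary: h)
    case 0
    have "emeasure (D 0) (space (D 0)) = 1"
      unfolding D_def by (rule prob_space.emeasure_space_1[OF prob_space_C[OF undef]])
    then show ?case
      unfolding step by (simp add: chain_step_def)
  next
    case (Suc n)
    have "(\<integral>\<^sup>+\<omega>. h (\<omega> (Suc n)) \<partial>D (Suc (Suc n))) = (\<integral>\<^sup>+\<omega>. pmf_operator K h (\<omega> n) \<partial>D (Suc n))"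
      unfolding step[of "Suc n" h] by (simp add: chain_step_def pmf_operator_def)
    then show ?case
      by (simp only: Suc funpow_Suc_right comp_def)
  qed
  define X where "X = {\<omega> \<in> space (PiM {0..<Suc n} ?M). \<omega> n = z}"
  have X: "X \<in> sets (PiM {0..<Suc n} ?M)"
  proof -
    have "(\<lambda>\<omega>. \<omega> n) \<in> measurable (PiM {0..<Suc n} ?M) (count_space UNIV)"
      by (rule measurable_component_singleton) simp
    from measurable_sets[OF this, of "{z}"] show ?thesis
      by (simp add: X_def vimage_def Int_def conj_commute)
  qed
  have eq: "{\<omega>. \<omega> n = z} = PF.emb UNIV {0..<Suc n} X"
    by (auto simp: X_def prod_emb_def space_PiM)
  have emb: "PF.emb {0..<Suc n} {0..<Suc n} X = X"
    by (rule prod_emb_id) (auto simp: X_def space_PiM)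
  have "emeasure (path_measure K x) {\<omega>. \<omega> n = z} = emeasure (CI {0..<Suc n}) X"
    unfolding eq path_measure_def by (rule lim) (simp_all add: X)
  also have "\<dots> = emeasure (D (Suc n)) X"
    using emeasure_CI[OF subset_refl X] unfolding emb D_def .
  also have "\<dots> = (\<integral>\<^sup>+\<omega>. indicator X \<omega> \<partial>D (Suc n))"
    by (simp add: setsD X)
  also have "\<dots> = (\<integral>\<^sup>+\<omega>. indicator {z} (\<omega> n) \<partial>D (Suc n))"
    by (rule nn_integral_cong) (simp add: spD X_def indicator_def)
  finally show ?thesis
    unfolding law .
qed

lemma transientI:
  assumes S: "countable S"
    and green: "\<And>x z. x \<in> S \<Longrightarrow> z \<in> S \<Longrightarrow> \<exists>C<\<top>. \<forall>N. partial_green K z N x \<le> C"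
  shows "transient S K"
  unfolding transient_def
proof
  fix x assume x: "x \<in> S"
  let ?P = "path_measure K x"
  have point: "AE \<omega> in ?P. \<forall>\<^sub>F n in sequentially. \<omega> n \<noteq> z" if z: "z \<in> S" for z
  proof -
    define p where "p n = emeasure ?P {\<omega>. \<omega> n = z}" for n
    have p_eq: "p n = (pmf_operator K ^^ n) (indicator {z}) x" for n
      by (simp add: p_def emeasure_path_measure_coordinate)
    have p_fin: "p n < \<top>" for n
      unfolding p_eq using pmf_operator_power_le_1 by (rule le_less_trans) (simp add: of_nat_less_top)
    obtain C where C: "C < \<top>" "\<And>N. partial_green K z N x \<le> C"
      using green[OF x z] by blast
    have "(\<Sum>n. p n) \<le> C"
      unfolding suminf_eq_SUP using C(2) by (intro SUP_least) (simp add: partial_green_def p_eq)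
    then have "(\<Sum>n. ennreal (measure ?P {\<omega>. \<omega> n = z})) \<noteq> \<top>"
      using C(1) p_fin by (auto simp: measure_def p_def)
    then have "summable (\<lambda>n. measure ?P {\<omega>. \<omega> n = z})"
      by (intro summable_suminf_not_top) auto
    moreover have "{\<omega>. \<omega> n = z} \<in> sets ?P" for n
    proof -
      have "(\<lambda>\<omega>. \<omega> n) \<in> measurable (PiM UNIV (\<lambda>_. count_space UNIV)) (count_space UNIV)"
        by (rule measurable_component_singleton) simp
      from measurable_sets[OF this, of "{z}"] show ?thesis
        by (simp add: sets_path_measure vimage_def space_PiM)
    qed
    ultimately have "AE \<omega> in ?P. \<forall>\<^sub>F n in sequentially. \<omega> \<in> space ?P - {\<omega>. \<omega> n = z}"
      using p_fin by (intro borel_cantelli_AE1) (auto simp: p_def)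
    then show ?thesis
      by simp
  qed
  then have "AE \<omega> in ?P. \<forall>z\<in>S. \<forall>\<^sub>F n in sequentially. \<omega> n \<noteq> z"
    using S by (simp add: AE_ball_countable)
  then show "AE \<omega> in ?P. \<forall>V. finite V \<and> V \<subseteq> S \<longrightarrow> (\<forall>\<^sub>F n in sequentially. \<omega> n \<notin> V)"
  proof (rule AE_mp, intro AE_I2 impI allI, elim conjE)
    fix \<omega> V assume "\<forall>z\<in>S. \<forall>\<^sub>F n in sequentially. \<omega> n \<noteq> z" "finite V" "V \<subseteq> S"
    then have "\<forall>\<^sub>F n in sequentially. \<forall>z\<in>V. \<omega> n \<noteq> z"
      by (intro eventually_ball_finite) auto
    then show "\<forall>\<^sub>F n in sequentially. \<omega> n \<notin> V"
      by (rule eventually_mono) blast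
  qed
qed

lemma countable_dyadic_rationals: "countable dyadic_rationals"
proof -
  have "dyadic_rationals = range (\<lambda>(a :: int, n :: nat). of_int a / 2 ^ n)"
    by (auto simp: dyadic_rationals_def)
  then show ?thesis by (metis countableI_type countable_image)
qed

lemma bij_thompson_F:
  assumes "g \<in> carrier thompson_F"
  shows "bij g"
proof -
  have "g \<in> carrier Homeo_real"
    using assms group.generate_in_carrier[OF group_Homeo_real generators_in_Homeo_real]
    by (simp add: thompson_F_def)
  then obtain h where "homeomorphism UNIV UNIV g h"
    by (auto simp: Homeo_real_def)
  then show ?thesis
    by (intro bij_betw_byWitness[where f' = h]) (auto simp: homeomorphism_def)
qed

theorem theorem25:
  fixes \<mu> :: "(real \<Rightarrow> real) pmf"
  assumes "set_pmf \<mu> \<subseteq> carrier thompson_F"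
    and "strictly_nondegenerate thompson_F \<mu>"
  shows "transient dyadic_rationals (induced_walk \<mu>)"
proof -
  have walk: "induced_walk \<mu> \<equiv> \<lambda>y. map_pmf (\<lambda>g. g y) \<mu>"
    by (rule eq_reflection) (simp add: induced_walk_def fun_eq_iff)
  interpret bijection_walk \<mu> "induced_walk \<mu>"
    by unfold_locales (use assms(1) bij_thompson_F in blast, fact walk)
  have gen: "semigroup_generated thompson_F (set_pmf \<mu>) = carrier thompson_F"
    using assms(2) by (simp add: strictly_nondegenerate_def)
  have group_bound: "\<exists>C<\<top>. \<forall>f. displacement g f \<le> C * energy f" if "g \<in> carrier thompson_F" for g
    using that[folded gen]
  proof induction
    case (incl g)
    then show ?case
      using displacement_le_energy by (intro exI[of _ "ennreal (1 / pmf \<mu> g)"]) auto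
  next
    case (mult g h)
    then obtain C C' where C: "C < \<top>" "C' < \<top>"
      "\<And>f. displacement g f \<le> C * energy f" "\<And>f. displacement h f \<le> C' * energy f"
      by blast
    have "displacement (h \<circ> g) f \<le> (2 * C + 2 * C') * energy f" for f
    proof -
      have "displacement (h \<circ> g) f \<le> 2 * displacement g f + 2 * displacement h f"
        using mult(1) gen by (intro displacement_comp bij_thompson_F) simp
      also have "\<dots> \<le> 2 * (C * energy f) + 2 * (C' * energy f)"
        using C by (intro add_mono mult_left_mono) auto
      finally show ?thesis by (simp add: algebra_simps)
    qed
    moreover have "g \<otimes>\<^bsub>thompson_F\<^esub> h = h \<circ> g"
      by (simp add: thompson_F_def Homeo_real_def)
    ultimately show ?case
      using C(1,2) by (intro exI[of _ "2 * C + 2 * C'"]) (simp add: ennreal_mult_less_top del: o_apply)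
  qed
  have "A_map \<in> carrier thompson_F" "B_map \<in> carrier thompson_F"
    by (auto simp: thompson_F_def intro: generate.incl)
  then obtain CA CB where CAB: "CA < \<top>" "CB < \<top>"
    "\<And>f. displacement A_map f \<le> CA * energy f" "\<And>f. displacement B_map f \<le> CB * energy f"
    using group_bound by metis
  have point_bound: "\<exists>C<\<top>. \<forall>z N. (partial_green (induced_walk \<mu>) z N x)\<^sup>2 \<le>
      C * partial_green (induced_walk \<mu>) z N z" for x
  proof -
    obtain C where C: "C < \<top>"
      "\<And>f. (\<integral>\<^sup>+y. ennreal ((f y)\<^sup>2) \<partial>count_space UNIV) < \<top> \<Longrightarrow>
        ennreal ((f x)\<^sup>2) \<le> C * (displacement A_map f + displacement B_map f)"
      using square_le_displacement_generators_all[of x] by blast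
    have "(partial_green (induced_walk \<mu>) z N x)\<^sup>2 \<le>
        C * ((CA + CB) * 2) * partial_green (induced_walk \<mu>) z N z" for z N
    proof -
      define u where "u = partial_green (induced_walk \<mu>) z N"
      define f where "f y = enn2real (u y)" for y
      have "u y < \<top>" for y
        using partial_green_le[of "induced_walk \<mu>" z N y] unfolding u_def
        by (rule le_less_trans) (simp add: of_nat_less_top)
      then have u: "(u y)\<^sup>2 = ennreal ((f y)\<^sup>2)" for y
        by (simp add: f_def ennreal_power[symmetric])
      have "(u x)\<^sup>2 \<le> C * (displacement A_map f + displacement B_map f)"
        unfolding u by (rule C(2)) (use nn_integral_partial_green_square[of z N] in \<open>simp add: u[symmetric] u_def\<close>)
      also have "\<dots> \<le> C * (CA * energy f + CB * energy f)"
        using CAB by (intro mult_left_mono add_mono) auto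
      also have "\<dots> \<le> C * (CA * (2 * u z) + CB * (2 * u z))"
        using energy_partial_green[of z N] unfolding f_def[abs_def] u_def
        by (intro mult_left_mono add_mono) auto
      finally show ?thesis
        by (simp add: u_def algebra_simps)
    qed
    then show ?thesis
      using C(1) CAB(1,2)
      by (intro exI[of _ "C * ((CA + CB) * 2)"]) (auto simp: ennreal_mult_less_top)
  qed
  have "\<exists>C<\<top>. \<forall>N. partial_green (induced_walk \<mu>) z N x \<le> C" for x z
  proof -
    let ?G = "partial_green (induced_walk \<mu>) z"
    obtain Cx Cz where C: "Cx < \<top>" "Cz < \<top>"
      "\<And>N. (?G N x)\<^sup>2 \<le> Cx * ?G N z" "\<And>N. (?G N z)\<^sup>2 \<le> Cz * ?G N z"
      using point_bound[of x] point_bound[of z] by blast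
    have "?G N x \<le> 1 + Cx * Cz" for N
    proof -
      have diag: "?G N z \<le> Cz"
      proof (cases "?G N z = 0")
        case False
        moreover have "?G N z < \<top>"
          using partial_green_le by (rule le_less_trans) (simp add: of_nat_less_top)
        ultimately show ?thesis
          using C(4)[of N] ennreal_mult_le_mult_iff[of "?G N z" "?G N z" Cz]
          by (simp add: power2_eq_square mult.commute)
      qed simp
      show ?thesis
      proof (cases "?G N x \<le> 1")
        case True
        then show ?thesis by (simp add: add_increasing2)
      next
        case False
        then have "?G N x * 1 \<le> ?G N x * ?G N x"
          by (intro mult_left_mono) auto
        also have "\<dots> \<le> Cx * ?G N z"
          using C(3)[of N] by (simp add: power2_eq_square)
        also have "\<dots> \<le> Cx * Cz"
          by (intro mult_left_mono diag) simp
        finally show ?thesis by (simp add: add_increasing)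
      qed
    qed
    then show ?thesis
      using C(1,2) by (intro exI[of _ "1 + Cx * Cz"]) (auto simp: ennreal_mult_less_top)
  qed
  then show ?thesis
    by (intro transientI countable_dyadic_rationals)
qed

end
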